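(* For any $b>0$ and $\gamma\in(0,1)$ there exists $C>0$ depending only on $b$ and $\gamma$ for which the following holds. Let $n\in\mathbb{N}$ be even and let $v\in\mathbb{R}^n$ satisfy $\|\mathrm{D}(v)\|_2\ge b\sqrt{n}$. Then for every $\alpha>0$ and $\varepsilon\ge0$, $$\mathcal{L}(W_v,\varepsilon)\le C\varepsilon+\frac{C}{\operatorname{CLCD}_{\alpha,\gamma}(v)}+Ce^{-2\alpha^2/n}.$$
   Context: For $v\in\mathbb{R}^n$, $\mathrm{D}(v)\in\mathbb{R}^{\binom n2}$ is the vector whose $(i,j)$-coordinate is $v_i-v_j$, $1\le i<j\le n$. For $\alpha,\gamma>0$, the Combinatorial Least Common Denominator of $v$ is $$\operatorname{CLCD}_{\alpha,\gamma}(v):=\inf\left\{\theta>0:\operatorname{dist}\left(\theta\mathrm{D}(v),\mathbb{Z}^{\binom n2}\right)<\min(\gamma\|\theta\mathrm{D}(v)\|_2,\alpha)\right\},$$ where $\operatorname{dist}$ is Euclidean distance (with $\inf\emptyset=\infty$ and $1/\infty=0$). For even $n$, $W_v:=\xi_1v_1+\dots+\xi_nv_n$, where $(\xi_1,\dots,\xi_n)$ is chosen uniformly from the set of vectors in $\{-1,0,1\}^n$ satisfying $\sum_{i=1}^n|\xi_i|=n/2$. The Lévy concentration function is $\mathcal{L}(X,\varepsilon):=\sup_{\lambda\in\mathbb{R}}\mathbf{P}(|X-\lambda|\le\varepsilon)$. *)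

theory Defs
  imports "HOL-Probability.Probability"
begin

text \<open>
  A vector in \<open>\<real>\<^sup>n\<close> is a function \<open>v :: nat \<Rightarrow> real\<close> of which only the entries
  \<open>v 1, \<dots>, v n\<close> are used; the dimension is an explicit argument because the constant in
  the theorem has to be uniform in it.  Likewise a vector in \<open>\<real>\<^sup>I\<close> for a finite index set
  \<open>I\<close> is a function considered on \<open>I\<close> only, with Euclidean norm \<^term>\<open>\<lambda>x. L2_set x I\<close>.
\<close>

definition pairs :: "nat \<Rightarrow> (nat \<times> nat) set" where
  "pairs n = {(i, j). 1 \<le> i \<and> i < j \<and> j \<le> n}"

definition diff_vec :: "(nat \<Rightarrow> real) \<Rightarrow> nat \<times> nat \<Rightarrow> real" where
  "diff_vec v = (\<lambda>(i, j). v i - v j)"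

definition dist_int_lattice :: "'i set \<Rightarrow> ('i \<Rightarrow> real) \<Rightarrow> real" where
  "dist_int_lattice I x = (INF z \<in> I \<rightarrow>\<^sub>E \<int>. L2_set (\<lambda>p. x p - z p) I)"

text \<open>
  The infimum is taken in \<^typ>\<open>ereal\<close>, so that the infimum of the empty set is \<open>\<infinity>\<close>;
  there also \<open>c / \<infinity> = 0\<close> for real \<open>c\<close>.
\<close>

definition CLCD :: "real \<Rightarrow> real \<Rightarrow> nat \<Rightarrow> (nat \<Rightarrow> real) \<Rightarrow> ereal" where
  "CLCD \<alpha> \<gamma> n v =
     Inf (ereal ` {\<theta>. \<theta> > 0 \<and>
       dist_int_lattice (pairs n) (\<lambda>p. \<theta> * diff_vec v p)
         < min (\<gamma> * L2_set (\<lambda>p. \<theta> * diff_vec v p) (pairs n)) \<alpha>})"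

definition sign_vectors :: "nat \<Rightarrow> (nat \<Rightarrow> real) set" where
  "sign_vectors n =
     {\<xi> \<in> {1..n} \<rightarrow>\<^sub>E {-1, 0, 1}. (\<Sum>i = 1..n. \<bar>\<xi> i\<bar>) = real n / 2}"

definition W :: "nat \<Rightarrow> (nat \<Rightarrow> real) \<Rightarrow> (nat \<Rightarrow> real) \<Rightarrow> real" where
  "W n v \<xi> = (\<Sum>i = 1..n. \<xi> i * v i)"

definition levy_conc :: "'a measure \<Rightarrow> ('a \<Rightarrow> real) \<Rightarrow> real \<Rightarrow> real" where
  "levy_conc M X \<epsilon> = (SUP c. measure M {\<omega> \<in> space M. \<bar>X \<omega> - c\<bar> \<le> \<epsilon>})"

end

theory Submission
  imports Defs
begin

text \<open>
  With \<open>x\<^sub>j = cos (s v\<^sub>j)\<close> and \<open>n = 2 m\<close>, the characteristic function of \<open>W\<^sub>v\<close> at \<open>s\<close> is the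
  \<open>m\<close>-th elementary symmetric mean of \<open>x\<^sub>1, \<dots>, x\<^sub>n\<close>, that is, up to normalisation, the \<open>m\<close>-th
  coefficient of \<open>\<Prod>\<^sub>j (1 + z x\<^sub>j)\<close>.  Cauchy's integral on a circle of radius \<open>1 / sqrt q\<close>,
  with \<open>q\<close> the mean of the \<open>x\<^sub>j\<^sup>2\<close> and \<open>\<mu>\<close> the mean of the \<open>x\<^sub>j\<close>, together with the inequality
  of arithmetic and geometric means for \<open>\<bar>1 + z x\<^sub>j\<bar>\<^sup>2\<close>, bounds it by a constant times
  \<open>sqrt ((q + \<mu>\<^sup>2) / 2)\<close> to the power \<open>m\<close>.  Now \<open>(q + \<mu>\<^sup>2) / 2\<close> is the average of
  \<open>((x\<^sub>i + x\<^sub>j) / 2)\<^sup>2\<close>, which is at most the average of \<open>cos\<^sup>2 (s (v\<^sub>i - v\<^sub>j) / 2)\<close>.  For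
  \<open>s = 2 \<pi> \<theta>\<close> this controls the characteristic function by \<open>exp (-2 d\<^sup>2 / n)\<close>, where \<open>d\<close> is the
  distance of \<open>\<theta> D(v)\<close> from the integer lattice.  Below the CLCD this distance is large, and
  smoothing with the Fejer kernel turns the bound into one for the concentration function.
\<close>

section \<open>Jordan's inequality and its consequences\<close>

text \<open>Jordan's inequality: \<open>- sin\<close> is convex on [0, pi/2] and so lies below its
  chord there.\<close>

lemma two_mult_div_pi_le_sin:
  assumes "0 \<le> x" "x \<le> pi / 2"
  shows "2 * x / pi \<le> sin x"
proof -
  have "convex_on {0..pi/2} (\<lambda>x. - sin x)"
  proof (rule f''_ge0_imp_convex)
    show "((\<lambda>x. - sin x) has_real_derivative - cos x) (at x)" for x
      by (auto intro!: derivative_eq_intros)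
    show "((\<lambda>x. - cos x) has_real_derivative sin x) (at x)" for x
      by (auto intro!: derivative_eq_intros)
    show "0 \<le> sin x" if "x \<in> {0..pi/2}" for x :: real
      using that by (intro sin_ge_zero) auto
  qed auto
  from convex_onD_Icc'[OF this, of x] assms show ?thesis
    by (simp add: field_simps)
qed

lemma square_le_sin_pi_squared:
  fixes y :: real
  assumes "\<bar>y\<bar> \<le> 1 / 2"
  shows "4 * y\<^sup>2 \<le> (sin (pi * y))\<^sup>2"
proof -
  have "2 * (pi * \<bar>y\<bar>) / pi \<le> sin (pi * \<bar>y\<bar>)"
    using assms by (intro two_mult_div_pi_le_sin) auto
  then have "(2 * \<bar>y\<bar>)\<^sup>2 \<le> (sin (pi * \<bar>y\<bar>))\<^sup>2"
    by (intro power_mono) auto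
  moreover have "(sin (pi * \<bar>y\<bar>))\<^sup>2 = (sin (pi * y))\<^sup>2"
    by (cases "y \<ge> 0") auto
  ultimately show ?thesis by simp
qed

text \<open>\<open>(cos (pi * x))^2\<close> has period 1, so \<open>x\<close> may be replaced by its
  offset \<open>y\<close> from the nearest integer. Here the distance to the integers enters the
  estimate of the cosines.\<close>

lemma cos_pi_squared_le_dist_round:
  fixes x :: real
  shows "(cos (pi * x))\<^sup>2 \<le> 1 - 4 * (x - of_int (round x))\<^sup>2"
proof -
  define y where "y = x - of_int (round x)"
  have "\<bar>y\<bar> \<le> 1 / 2"
    using of_int_round_abs_le[of x] by (simp add: y_def abs_minus_commute)
  then have 1: "4 * y\<^sup>2 \<le> (sin (pi * y))\<^sup>2"
    by (rule square_le_sin_pi_squared)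
  have "sin (pi * of_int (round x)) = 0"
    by (metis mult.commute sin_zero_iff_int2)
  then have "(cos (pi * of_int (round x)))\<^sup>2 = 1"
    by (simp add: cos_squared_eq)
  then have "(sin (pi * y))\<^sup>2 = (sin (pi * x))\<^sup>2"
    using \<open>sin (pi * of_int (round x)) = 0\<close>
    by (simp add: y_def right_diff_distrib sin_diff power_mult_distrib)
  with 1 show ?thesis by (simp add: y_def cos_squared_eq)
qed

section \<open>Gaussian integrals\<close>

text \<open>The integrand is positive, so the interval may be enlarged to the whole line, where it
  is a multiple of a normal density.\<close>

lemma integral_gaussian_le:
  fixes \<mu> \<sigma> a b :: real
  assumes "\<sigma> > 0"
  shows "integral {a..b} (\<lambda>x. exp (- (x - \<mu>)\<^sup>2 / (2 * \<sigma>\<^sup>2))) \<le> sqrt (2 * pi * \<sigma>\<^sup>2)"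
proof -
  let ?g = "\<lambda>x. exp (- (x - \<mu>)\<^sup>2 / (2 * \<sigma>\<^sup>2))"
  have c: "continuous_on {a..b} ?g"
    using assms by (intro continuous_intros) auto
  have int: "set_integrable lborel {a..b} ?g"
    by (rule borel_integrable_atLeastAtMost'[OF c])
  have eq: "?g = (\<lambda>x. sqrt (2 * pi * \<sigma>\<^sup>2) * normal_density \<mu> \<sigma> x)"
    using assms by (auto simp: normal_density_def fun_eq_iff)
  have int': "integrable lborel ?g"
    unfolding eq using assms by auto
  have "integral {a..b} ?g = (LINT x:{a..b}|lborel. ?g x)"
    using set_borel_integral_eq_integral(2)[OF int] by simp
  also have "\<dots> \<le> (LINT x|lborel. ?g x)"
    unfolding set_lebesgue_integral_def
    using int int' unfolding set_integrable_def
    by (intro integral_mono) (auto simp: indicator_def)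
  also have "\<dots> = sqrt (2 * pi * \<sigma>\<^sup>2)"
    unfolding eq using assms by simp
  finally show ?thesis .
qed

text \<open>The integrand peaks at the zeros 0, pi and 2 pi of the sine. Each point lies within pi/2
  of one of them and is dominated by the Gaussian centred there. The resulting decay like 1 / sqrt m
  later cancels the sqrt m lost in counting sign vectors.\<close>

lemma integral_exp_sin_squared_le:
  assumes "m > (0::real)"
  shows "integral {0..2*pi} (\<lambda>x. exp (- m * (sin x)\<^sup>2 / 4)) \<le> 3 * sqrt (pi ^ 3 / m)"
proof -
  \<comment> \<open>With this variance the exponent of the Gaussian centred at k pi is
    \<open>- m * y^2\<close> for \<open>y = (x - k pi) / pi\<close>, and Jordan's inequality gives
    \<open>m * y^2 \<le> m * (sin x)^2 / 4\<close>.\<close>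
  define \<sigma> where "\<sigma> = pi / sqrt (2 * m)"
  have \<sigma>: "\<sigma> > 0" "\<sigma>\<^sup>2 = pi\<^sup>2 / (2 * m)"
    using assms by (auto simp: \<sigma>_def power_divide)
  let ?g = "\<lambda>\<mu> x. exp (- (x - \<mu>)\<^sup>2 / (2 * \<sigma>\<^sup>2))"
  have near: "exp (- m * (sin x)\<^sup>2 / 4) \<le> ?g (of_int k * pi) x"
    if "\<bar>x - of_int k * pi\<bar> \<le> pi / 2" for x k
  proof -
    define y where "y = x / pi - of_int k"
    have xy: "x = pi * y + pi * of_int k" by (simp add: y_def field_simps)
    have "\<bar>y\<bar> = \<bar>x - of_int k * pi\<bar> / pi"
      by (simp add: y_def field_simps)
    also have "\<dots> \<le> (pi / 2) / pi" using that by (intro divide_right_mono) auto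
    finally have "\<bar>y\<bar> \<le> 1 / 2" by simp
    then have 1: "4 * y\<^sup>2 \<le> (sin (pi * y))\<^sup>2" by (rule square_le_sin_pi_squared)
    have s0: "sin (pi * of_int k) = 0"
      by (metis mult.commute sin_zero_iff_int2)
    then have "(cos (pi * of_int k))\<^sup>2 = 1"
      by (simp add: cos_squared_eq)
    then have "(sin x)\<^sup>2 = (sin (pi * y))\<^sup>2"
      using s0 by (simp add: xy sin_add power_mult_distrib)
    with 1 have "m * (4 * y\<^sup>2) / 4 \<le> m * (sin x)\<^sup>2 / 4"
      using assms by (intro divide_right_mono mult_left_mono) auto
    moreover have "(x - of_int k * pi)\<^sup>2 / (2 * \<sigma>\<^sup>2) = m * y\<^sup>2"
      using assms by (simp add: \<sigma> xy power_mult_distrib field_simps)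
    ultimately show ?thesis by simp
  qed
  have le: "exp (- m * (sin x)\<^sup>2 / 4) \<le> ?g 0 x + ?g pi x + ?g (2 * pi) x"
    if "x \<in> {0..2*pi}" for x
  proof -
    consider "x \<le> pi / 2" | "pi / 2 \<le> x" "x \<le> 3 * pi / 2" | "3 * pi / 2 \<le> x"
      by linarith
    then show ?thesis
    proof cases
      case 1
      with that near[of x 0] show ?thesis
        by (simp add: abs_le_iff add_increasing2)
    next
      case 2
      then have "\<bar>x - of_int 1 * pi\<bar> \<le> pi / 2"
        unfolding of_int_1 abs_le_iff by linarith
      from near[OF this] have "exp (- m * (sin x)\<^sup>2 / 4) \<le> ?g pi x" by simp
      also have "\<dots> \<le> ?g 0 x + ?g pi x + ?g (2 * pi) x"
        by (simp add: add_increasing)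
      finally show ?thesis .
    next
      case 3
      with that near[of x 2] show ?thesis
        by (simp add: abs_le_iff add_increasing)
    qed
  qed
  have c: "?g \<mu> integrable_on {0..2*pi}" for \<mu>
    using \<sigma>(1) by (intro integrable_continuous_interval continuous_intros) auto
  have "integral {0..2*pi} (\<lambda>x. exp (- m * (sin x)\<^sup>2 / 4))
      \<le> integral {0..2*pi} (\<lambda>x. ?g 0 x + ?g pi x + ?g (2 * pi) x)"
    by (intro integral_le integrable_add c le)
      (auto intro!: integrable_continuous_interval continuous_intros)
  also have "\<dots> = integral {0..2*pi} (?g 0) + integral {0..2*pi} (?g pi) + integral {0..2*pi} (?g (2*pi))"
    by (subst integral_add, intro integrable_add c, rule c, subst integral_add) (auto simp only: c)
  also have "\<dots> \<le> 3 * sqrt (2 * pi * \<sigma>\<^sup>2)"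
    using integral_gaussian_le[OF \<sigma>(1), of 0 "2*pi" 0] integral_gaussian_le[OF \<sigma>(1), of 0 "2*pi" pi]
      integral_gaussian_le[OF \<sigma>(1), of 0 "2*pi" "2*pi"] by linarith
  also have "2 * pi * \<sigma>\<^sup>2 = pi ^ 3 / m"
    unfolding \<sigma>(2) using assms by (simp add: power2_eq_square power3_eq_cube)
  finally show ?thesis .
qed

section \<open>Central binomial coefficients and the inequality of means\<close>

text \<open>The squared form is proved by induction: the recursion
  \<open>(m + 1) c' = 2 (2 m + 1) c\<close> for the central coefficients reduces the step to
  \<open>4 m (m + 1) \<le> (2 m + 1)^2\<close>.\<close>

lemma central_binomial_lower_bound_sqrt:
  assumes "m > 0"
  shows "4 ^ m \<le> 2 * sqrt (real m) * real ((2 * m) choose m)"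
proof -
  have "16 ^ m \<le> 4 * real m * (real ((2 * m) choose m))\<^sup>2"
    using assms
  proof (induction m rule: nat_induct_non_zero)
    case 1
    then show ?case by (simp add: numeral_2_eq_2)
  next
    case (Suc m)
    let ?c = "real ((2 * m) choose m)"
    let ?c' = "real ((2 * Suc m) choose Suc m)"
    have "Suc m * ((2 * m + 1) choose m) = (2 * m + 1) * ((2 * m) choose m)"
      using binomial_absorb_comp[of "2 * m + 1" m] by simp
    moreover have "2 * Suc m * ((2 * m + 1) choose m) = ((2 * Suc m) choose Suc m) * Suc m"
      using Suc_times_binomial_eq[of "2 * m + 1" m] by simp
    ultimately have "Suc m * ((2 * Suc m) choose Suc m) = 2 * (2 * m + 1) * ((2 * m) choose m)"
      by (metis (no_types, lifting) mult.assoc mult.commute)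
    then have eq: "(real m + 1) * ?c' = 2 * (2 * real m + 1) * ?c"
      by (metis (no_types, opaque_lifting) of_nat_Suc of_nat_add of_nat_mult of_nat_numeral of_nat_1 add.commute)
    have "16 ^ Suc m * (real m + 1) = 16 * (real m + 1) * 16 ^ m"
      by simp
    also have "\<dots> \<le> 16 * (real m + 1) * (4 * real m * ?c\<^sup>2)"
      by (intro mult_left_mono Suc.IH) auto
    also have "\<dots> \<le> 4 * (2 * (2 * real m + 1) * ?c)\<^sup>2"
    proof -
      have "64 * (real m * (real m + 1)) * ?c\<^sup>2 \<le> 16 * (2 * real m + 1)\<^sup>2 * ?c\<^sup>2"
        by (intro mult_right_mono) (auto simp: power2_eq_square algebra_simps)
      moreover have "16 * (real m + 1) * (4 * real m * ?c\<^sup>2) = 64 * (real m * (real m + 1)) * ?c\<^sup>2"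
        by simp
      moreover have "4 * (2 * (2 * real m + 1) * ?c)\<^sup>2 = 16 * (2 * real m + 1)\<^sup>2 * ?c\<^sup>2"
        unfolding power_mult_distrib by simp
      ultimately show ?thesis by linarith
    qed
    also have "\<dots> = 4 * (real m + 1) * ?c'\<^sup>2 * (real m + 1)"
      unfolding eq[symmetric] by (simp add: power2_eq_square)
    finally show ?case by (simp del: binomial_Suc_Suc mult_Suc_right add: add.commute)
  qed
  then have "sqrt (16 ^ m) \<le> sqrt (4 * real m * (real ((2 * m) choose m))\<^sup>2)"
    by (rule real_sqrt_le_mono)
  moreover have "sqrt (16 ^ m) = 4 ^ m"
    by (simp add: real_sqrt_power)
  ultimately show ?thesis by (simp add: real_sqrt_mult)
qed

lemma prod_le_mean_power:
  fixes a :: "'a \<Rightarrow> real"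
  assumes "finite A" "A \<noteq> {}" "\<And>i. i \<in> A \<Longrightarrow> a i \<ge> 0"
  shows "(\<Prod>i\<in>A. a i) \<le> ((\<Sum>i\<in>A. a i) / card A) ^ card A"
proof -
  have c: "card A > 0" using assms by (simp add: card_gt_0_iff)
  let ?P = "\<Prod>i\<in>A. a i"
  have "?P \<ge> 0" using assms by (simp add: prod_nonneg)
  have "?P = (?P powr (1 / card A)) ^ card A"
    using c \<open>?P \<ge> 0\<close> by (cases "?P = 0") (auto simp: powr_power)
  also have "\<dots> \<le> (\<Sum>i\<in>A. a i / card A) ^ card A"
    by (intro power_mono arith_geom_mean assms) auto
  finally show ?thesis by (simp add: sum_divide_distrib)
qed

section \<open>Fourier integrals and the Fejer kernel\<close>

text \<open>Orthogonality of the characters of the circle, used to pick out one coefficient of a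
  polynomial in \<open>cis x\<close>.\<close>

lemma has_integral_cis_Ints:
  assumes "k \<in> \<int>"
  shows "((\<lambda>x. cis (k * x)) has_integral (if k = 0 then 2 * pi else 0)) {0..2*pi}"
proof (cases "k = 0")
  case True
  have "((\<lambda>x::real. 1::complex) has_integral (2 * pi) *\<^sub>R 1) {0..2*pi}"
    using has_integral_const_real[of "1::complex" 0 "2*pi"] by simp
  with True show ?thesis by (simp add: scaleR_conv_of_real)
next
  case False
  have "((\<lambda>x. cis (k * x)) has_integral
      cis (k * (2*pi)) / (\<i> * k) - cis (k * 0) / (\<i> * k)) {0..2*pi}"
  proof (rule fundamental_theorem_of_calculus)
    fix x
    have "((\<lambda>z. exp (\<i> * (k * z)) / (\<i> * k)) has_field_derivative exp (\<i> * (k * x))) (at (of_real x))"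
      using False by (auto intro!: derivative_eq_intros simp: complex_eq_iff)
    from has_vector_derivative_real_field[OF this]
    show "((\<lambda>x. cis (k * x) / (\<i> * k)) has_vector_derivative cis (k * x)) (at x within {0..2*pi})"
      by (simp add: cis_conv_exp)
  qed auto
  moreover have "cis (k * (2*pi)) = 1"
    using cis_multiple_2pi[OF assms] by (simp add: mult.commute)
  ultimately show ?thesis using False by simp
qed

text \<open>The cosine transform of the triangular weight \<open>1 - t\<close> is a Fejer kernel,
  hence nonnegative; \<open>1 / 2\<close> is its limit at 0.\<close>

lemma has_integral_fejer:
  fixes x :: real
  shows "((\<lambda>t. (1 - t) * cos (t * x)) has_integral (if x = 0 then 1 / 2 else (1 - cos x) / x\<^sup>2)) {0..1}"
proof (cases "x = 0")
  case True
  have "((\<lambda>t::real. 1 - t) has_integral (1 - 1\<^sup>2 / 2) - (0 - 0\<^sup>2 / 2)) {0..1}"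
    by (rule fundamental_theorem_of_calculus)
      (auto intro!: derivative_eq_intros simp flip: has_real_derivative_iff_has_vector_derivative)
  with True show ?thesis by simp
next
  case False
  let ?F = "\<lambda>t. (1 - t) * sin (t * x) / x - cos (t * x) / x\<^sup>2"
  have "((\<lambda>t. (1 - t) * cos (t * x)) has_integral ?F 1 - ?F 0) {0..1}"
    using False
    by (intro fundamental_theorem_of_calculus)
      (auto intro!: derivative_eq_intros simp: field_simps power2_eq_square
        simp flip: has_real_derivative_iff_has_vector_derivative)
  with False show ?thesis by (simp add: diff_divide_distrib)
qed

text \<open>The kernel is nonnegative everywhere, and for 0 < |x| \<le> 1 Jordan's inequality bounds
  it below by 2 / pi^2. The factor 5 suffices because pi^2 < 10.\<close>

lemma indicator_le_fejer:
  fixes x :: real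
  shows "of_bool (\<bar>x\<bar> \<le> 1) \<le> 5 * integral {0..1} (\<lambda>t. (1 - t) * cos (t * x))"
proof -
  have I: "integral {0..1} (\<lambda>t. (1 - t) * cos (t * x)) = (if x = 0 then 1 / 2 else (1 - cos x) / x\<^sup>2)"
    by (rule integral_unique[OF has_integral_fejer])
  show ?thesis
  proof (cases "x \<noteq> 0 \<and> \<bar>x\<bar> \<le> 1")
    case True
    have "\<bar>x\<bar> \<le> pi" using True pi_gt3 by linarith
    then have "\<bar>x / (2 * pi)\<bar> \<le> 1 / 2"
      by (simp add: abs_mult field_simps)
    then have "4 * (x / (2 * pi))\<^sup>2 \<le> (sin (pi * (x / (2 * pi))))\<^sup>2"
      by (rule square_le_sin_pi_squared)
    then have "x\<^sup>2 / pi\<^sup>2 \<le> (sin (x / 2))\<^sup>2"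
      by (simp add: power_divide power_mult_distrib)
    then have "2 * x\<^sup>2 / pi\<^sup>2 \<le> 1 - cos x"
      using cos_double_sin[of "x / 2"] by simp
    then have "2 / pi\<^sup>2 \<le> (1 - cos x) / x\<^sup>2"
      using True by (simp add: field_simps)
    moreover have "pi\<^sup>2 \<le> 3.15\<^sup>2"
      using pi_approx by (intro power_mono) auto
    then have "1 / 5 \<le> 2 / pi\<^sup>2"
      by (simp add: field_simps power2_eq_square)
    ultimately have "1 / 5 \<le> (1 - cos x) / x\<^sup>2" by linarith
    with True show ?thesis unfolding I by simp
  qed (auto simp: I)
qed

section \<open>Counting the sign vectors\<close>

lemma finite_sign_vectors: "finite (sign_vectors n)"
proof -
  have "finite ({1..n} \<rightarrow>\<^sub>E {-1, 0, 1::real})"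
    by (intro finite_PiE) auto
  then show ?thesis by (simp add: sign_vectors_def)
qed

lemma sum_abs_eq_card_support:
  fixes \<xi> :: "nat \<Rightarrow> real"
  assumes "\<xi> \<in> {1..n} \<rightarrow>\<^sub>E {-1, 0, 1::real}"
  shows "(\<Sum>i = 1..n. \<bar>\<xi> i\<bar>) = card {i \<in> {1..n}. \<xi> i \<noteq> 0}"
proof -
  have "(\<Sum>i = 1..n. \<bar>\<xi> i\<bar>) = (\<Sum>i = 1..n. of_bool (\<xi> i \<noteq> 0))"
  proof (intro sum.cong refl)
    fix i assume "i \<in> {1..n}"
    with assms have "\<xi> i \<in> {-1, 0, 1}" by (rule PiE_mem)
    then show "\<bar>\<xi> i\<bar> = of_bool (\<xi> i \<noteq> 0)" by auto
  qed
  also have "\<dots> = card ({1..n} \<inter> {i. \<xi> i \<noteq> 0})" by simp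
  also have "{1..n} \<inter> {i. \<xi> i \<noteq> 0} = {i \<in> {1..n}. \<xi> i \<noteq> 0}" by auto
  finally show ?thesis .
qed

text \<open>A support \<open>A\<close> of size \<open>m\<close> and a subset \<open>B\<close> of it
  give the vector that is 1 on \<open>B\<close>, -1 on \<open>A - B\<close> and 0 elsewhere. Both
  sets can be read off the vector, so this map is injective.\<close>

lemma card_sign_vectors_ge:
  "2 ^ m * ((2 * m) choose m) \<le> card (sign_vectors (2 * m))"
proof -
  define I where "I = {1..2 * m}"
  define f :: "nat set \<times> nat set \<Rightarrow> nat \<Rightarrow> real"
    where "f = (\<lambda>(A, B). \<lambda>i\<in>I. if i \<in> B then 1 else if i \<in> A then -1 else 0)"
  let ?S = "SIGMA A:{A. A \<subseteq> I \<and> card A = m}. Pow A"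
  have supp: "{i \<in> I. f (A, B) i \<noteq> 0} = A" and pos: "{i \<in> I. f (A, B) i = 1} = B"
    if "A \<subseteq> I" "B \<subseteq> A" for A B
    using that by (auto simp: f_def)
  have fin: "finite A" if "A \<subseteq> I" for A
    using that by (rule finite_subset) (simp add: I_def)
  have "card ?S = (\<Sum>A | A \<subseteq> I \<and> card A = m. card (Pow A))"
    by (intro card_SigmaI) (auto simp: fin)
  also have "\<dots> = (\<Sum>A | A \<subseteq> I \<and> card A = m. 2 ^ m)"
    by (intro sum.cong refl) (auto simp: card_Pow fin)
  also have "\<dots> = 2 ^ m * ((2 * m) choose m)"
    by (simp add: n_subsets fin) (simp add: I_def)
  finally have "card ?S = 2 ^ m * ((2 * m) choose m)" .
  moreover have "card ?S \<le> card (sign_vectors (2 * m))"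
  proof (rule card_inj_on_le)
    show "inj_on f ?S"
    proof (rule inj_on_inverseI)
      fix p assume "p \<in> ?S"
      then show "(\<lambda>h. ({i \<in> I. h i \<noteq> 0}, {i \<in> I. h i = 1})) (f p) = p"
        by (cases p) (simp only: supp pos mem_Sigma_iff mem_Collect_eq Pow_iff)
    qed
    show "f ` ?S \<subseteq> sign_vectors (2 * m)"
    proof (rule image_subsetI)
      fix p assume "p \<in> ?S"
      then obtain A B where p: "p = (A, B)" and AB: "A \<subseteq> I" "card A = m" "B \<subseteq> A" by auto
      have f: "f p \<in> {1..2 * m} \<rightarrow>\<^sub>E {-1, 0, 1}"
        by (auto simp: f_def p I_def)
      then have "(\<Sum>i = 1..2 * m. \<bar>f p i\<bar>) = m"
        using sum_abs_eq_card_support[of "f p" "2 * m"] supp[OF AB(1,3)] AB(2)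
        by (simp only: p I_def)
      with f show "f p \<in> sign_vectors (2 * m)"
        unfolding sign_vectors_def by simp
    qed
  qed (rule finite_sign_vectors)
  ultimately show ?thesis by simp
qed

lemma eight_power_le_card_sign_vectors:
  assumes "m > 0"
  shows "8 ^ m \<le> 2 * sqrt m * card (sign_vectors (2 * m))"
proof -
  have "(8::real) ^ m = 2 ^ m * 4 ^ m"
    by (simp flip: power_mult_distrib)
  also have "\<dots> \<le> 2 ^ m * (2 * sqrt m * ((2 * m) choose m))"
    using central_binomial_lower_bound_sqrt[OF assms] by simp
  also have "\<dots> = 2 * sqrt m * real (2 ^ m * ((2 * m) choose m))"
    by simp
  also have "\<dots> \<le> 2 * sqrt m * card (sign_vectors (2 * m))"
    by (intro mult_left_mono of_nat_mono card_sign_vectors_ge) auto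
  finally show ?thesis .
qed

section \<open>The characteristic function as a contour integral\<close>

text \<open>Cauchy's formula with \<open>z = r * cis x\<close>: expanding the product gives one term
  for each vector over {-1, 0, 1}, with \<open>z\<close> raised to the size of its support.
  Integration against \<open>cis (- m * x)\<close> keeps only supports of size
  \<open>m\<close>.\<close>

lemma has_integral_generating_function:
  fixes r s :: real
  shows "((\<lambda>x. cis (- real m * x) * (\<Prod>j = 1..2 * m. 1 + 2 * r * cis x * cos (s * v j)))
    has_integral r ^ m * (2 * pi) * (\<Sum>\<xi>\<in>sign_vectors (2 * m). cis (s * W (2 * m) v \<xi>))) {0..2*pi}"
proof -
  let ?n = "2 * m"
  let ?P = "{1..?n} \<rightarrow>\<^sub>E {-1, 0, 1::real}"
  define N where "N = (\<lambda>\<xi>::nat \<Rightarrow> real. card {i \<in> {1..?n}. \<xi> i \<noteq> 0})"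
  \<comment> \<open>The contribution of entry \<open>y\<close> at index \<open>j\<close>: the factor
    \<open>r * cis x\<close> marks a nonzero entry. The terms for \<open>y = 1\<close> and
    \<open>y = -1\<close> add up to the cosine.\<close>
  define g where "g = (\<lambda>x j y. (if y = 0 then 1 else r * cis x) * cis (s * (y * v j)))"
  have prod_g: "(\<Prod>j = 1..?n. g x j (\<xi> j)) = r ^ N \<xi> * cis (N \<xi> * x) * cis (s * W ?n v \<xi>)" for x :: real and \<xi>
  proof -
    have "(\<Prod>j = 1..?n. if \<xi> j = 0 then 1 else r * cis x) = r ^ N \<xi> * cis (N \<xi> * x)"
      unfolding Complex.DeMoivre[symmetric]
      by (simp add: prod.If_cases N_def Int_def power_mult_distrib)
    moreover have "(\<Prod>j\<in>A. cis (h j)) = cis (\<Sum>j\<in>A. h j)" if "finite A" for A and h :: "nat \<Rightarrow> real"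
      using that by (induction A rule: finite_induct) (auto simp: cis_mult)
    ultimately show ?thesis
      by (simp add: g_def prod.distrib W_def sum_distrib_left)
  qed
  have "cis (- real m * x) * (\<Prod>j = 1..?n. 1 + 2 * r * cis x * cos (s * v j))
      = (\<Sum>\<xi>\<in>?P. cis ((real (N \<xi>) - real m) * x) * (r ^ N \<xi> * cis (s * W ?n v \<xi>)))" for x
  proof -
    have "(\<Prod>j = 1..?n. 1 + 2 * r * cis x * cos (s * v j)) = (\<Prod>j = 1..?n. \<Sum>y\<in>{-1, 0, 1}. g x j y)"
      by (intro prod.cong refl) (simp add: g_def complex_eq_iff algebra_simps)
    also have "\<dots> = (\<Sum>\<xi>\<in>?P. r ^ N \<xi> * cis (N \<xi> * x) * cis (s * W ?n v \<xi>))"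
      by (subst prod_sum_PiE) (auto simp: prod_g simp del: One_nat_def)
    finally have eq: "(\<Prod>j = 1..?n. 1 + 2 * r * cis x * cos (s * v j))
      = (\<Sum>\<xi>\<in>?P. r ^ N \<xi> * cis (N \<xi> * x) * cis (s * W ?n v \<xi>))" .
    have "cis ((real k - real m) * x) = cis (- real m * x) * cis (k * x)" for k
      by (simp add: cis_mult algebra_simps)
    then show ?thesis
      unfolding eq sum_distrib_left by (simp only: mult_ac)
  qed
  moreover have "((\<lambda>x. \<Sum>\<xi>\<in>?P. cis ((real (N \<xi>) - real m) * x) * (r ^ N \<xi> * cis (s * W ?n v \<xi>)))
      has_integral (\<Sum>\<xi>\<in>?P. (if real (N \<xi>) - real m = 0 then 2 * pi else 0) * (r ^ N \<xi> * cis (s * W ?n v \<xi>))))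
      {0..2*pi}"
    by (intro has_integral_sum has_integral_mult_left has_integral_cis_Ints finite_PiE) auto
  moreover have "(\<Sum>\<xi>\<in>?P. (if real (N \<xi>) - real m = 0 then 2 * pi else 0) * (r ^ N \<xi> * cis (s * W ?n v \<xi>)))
      = r ^ m * (2 * pi) * (\<Sum>\<xi>\<in>sign_vectors ?n. cis (s * W ?n v \<xi>))"
  proof -
    have "sign_vectors ?n = {\<xi> \<in> ?P. N \<xi> = m}"
      by (auto simp: sign_vectors_def sum_abs_eq_card_support N_def simp del: One_nat_def)
    moreover have "finite ?P" by (intro finite_PiE) auto
    ultimately show ?thesis
      by (simp add: sum_distrib_left) (auto simp: sum.inter_filter intro!: sum.cong)
  qed
  ultimately show ?thesis by simp
qed

text \<open>\<open>Q\<close> may be any positive upper bound for the mean of the squared cosines,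
  which leaves room to choose it later. The contour integral is bounded pointwise by the inequality
  of means and then integrated.\<close>

lemma norm_char_sum_le:
  fixes s Q :: real
  assumes "m > 0" "Q > 0"
    and Q: "(\<Sum>j = 1..2 * m. (cos (s * v j))\<^sup>2) \<le> 2 * m * Q"
  defines "\<mu> \<equiv> (\<Sum>j = 1..2 * m. cos (s * v j)) / (2 * m)"
  shows "norm (\<Sum>\<xi>\<in>sign_vectors (2 * m). cis (s * W (2 * m) v \<xi>))
    \<le> 6 * card (sign_vectors (2 * m)) * sqrt ((Q + \<mu>\<^sup>2) / 2) ^ m"
proof -
  let ?n = "2 * m"
  define x where "x = (\<lambda>j. cos (s * v j))"
  \<comment> \<open>The radius of the circle: \<open>R^2 * Q = 1\<close> turns the bound for the
    mean of \<open>|1 + z x j|^2\<close> into \<open>A = 2 + 2 (R \<mu>) cos t\<close>.\<close>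
  define R where "R = 1 / sqrt Q"
  have R: "R > 0" "R\<^sup>2 * Q = 1" using assms by (auto simp: R_def power_divide)
  define K where "K = sqrt (8 * (1 + (R * \<mu>)\<^sup>2))"
  define M where "M = sqrt ((Q + \<mu>\<^sup>2) / 2)"
  let ?S = "\<Sum>\<xi>\<in>sign_vectors ?n. cis (s * W ?n v \<xi>)"
  \<comment> \<open>The factors of the generating function carry \<open>2 * r\<close>, so radius
    \<open>R\<close> means \<open>r = R / 2\<close>.\<close>
  let ?F = "\<lambda>t. cis (- real m * t) * (\<Prod>j = 1..?n. 1 + 2 * (R / 2) * cis t * cos (s * v j))"
  have le: "norm (?F t) \<le> K ^ m * exp (- m * (sin t)\<^sup>2 / 4)" for t
  proof -
    define a where "a = (\<lambda>j. 1 + 2 * R * cos t * x j + R\<^sup>2 * (x j)\<^sup>2)"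
    define A where "A = 2 + 2 * (R * \<mu>) * cos t"
    have a: "(norm (1 + 2 * (R / 2) * cis t * cos (s * v j)))\<^sup>2 = a j" for j
    proof -
      have "(norm (1 + 2 * (R / 2) * cis t * cos (s * v j)))\<^sup>2
          = (1 + R * cos t * x j)\<^sup>2 + (R * sin t * x j)\<^sup>2"
        by (simp add: cmod_power2 x_def)
      also have "\<dots> = 1 + 2 * R * cos t * x j + R\<^sup>2 * (x j)\<^sup>2 * ((sin t)\<^sup>2 + (cos t)\<^sup>2)"
        by (simp only: power2_eq_square) algebra
      finally show ?thesis by (simp add: a_def)
    qed
    have a0: "a j \<ge> 0" for j by (simp flip: a)
    have "(\<Sum>j = 1..?n. a j) = ?n + 2 * R * cos t * (\<Sum>j = 1..?n. x j) + R\<^sup>2 * (\<Sum>j = 1..?n. (x j)\<^sup>2)"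
      by (simp add: a_def sum.distrib sum_distrib_left)
    also have "\<dots> \<le> ?n + 2 * R * cos t * (?n * \<mu>) + R\<^sup>2 * (?n * Q)"
    proof -
      have "(\<Sum>j = 1..?n. x j) = ?n * \<mu>"
        using \<open>m > 0\<close> by (simp add: \<mu>_def x_def)
      moreover have "R\<^sup>2 * (\<Sum>j = 1..?n. (x j)\<^sup>2) \<le> R\<^sup>2 * (?n * Q)"
        using Q by (intro mult_left_mono) (auto simp: x_def)
      ultimately show ?thesis by simp
    qed
    also have "\<dots> = ?n * (1 + 2 * (R * \<mu>) * cos t + R\<^sup>2 * Q)"
      by (simp add: algebra_simps)
    also have "\<dots> = ?n * A" unfolding R A_def by simp
    finally have mean: "(\<Sum>j = 1..?n. a j) / ?n \<le> A"
      using \<open>m > 0\<close> by (simp add: field_simps)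
    have "0 \<le> (\<Sum>j = 1..?n. a j) / ?n" using a0 by (simp add: sum_nonneg)
    with mean have "A \<ge> 0" by linarith
    have "(norm (?F t))\<^sup>2 = (\<Prod>j = 1..?n. a j)"
      by (simp only: norm_mult norm_cis prod_norm[symmetric] prod_power_distrib a mult_1)
    also have "\<dots> \<le> ((\<Sum>j = 1..?n. a j) / ?n) ^ ?n"
      using prod_le_mean_power[of "{1..?n}" a] a0 \<open>m > 0\<close> by simp
    also have "\<dots> \<le> A ^ ?n"
      using mean a0 by (intro power_mono) (auto simp: sum_nonneg)
    also have "\<dots> = (A ^ m)\<^sup>2" by (simp add: power_even_eq)
    finally have 1: "norm (?F t) \<le> A ^ m"
      by (rule power2_le_imp_le) (use \<open>A \<ge> 0\<close> in simp)
    have "A\<^sup>2 = 4 * (1 + (R * \<mu>) * cos t)\<^sup>2"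
      by (simp add: A_def power2_eq_square algebra_simps)
    \<comment> \<open>Cauchy-Schwarz in the form
      \<open>(1 + a b)^2 \<le> (1 + a^2) (1 + b^2)\<close>, the difference being
      \<open>(a - b)^2\<close>. It separates \<open>\<mu>\<close> from \<open>t\<close>.\<close>
    also have "\<dots> \<le> 4 * ((1 + (R * \<mu>)\<^sup>2) * (1 + (cos t)\<^sup>2))"
      using zero_le_power2[of "R * \<mu> - cos t"] by (simp add: power2_eq_square algebra_simps)
    also have "\<dots> = K\<^sup>2 * (1 - (sin t)\<^sup>2 / 2)"
      by (simp add: K_def add_nonneg_nonneg cos_squared_eq algebra_simps)
    also have "\<dots> \<le> K\<^sup>2 * exp (- (sin t)\<^sup>2 / 2)"
      using exp_ge_add_one_self[of "- (sin t)\<^sup>2 / 2"] by (intro mult_left_mono) auto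
    also have "\<dots> = (K * exp (- (sin t)\<^sup>2 / 4))\<^sup>2"
      by (simp add: power_mult_distrib flip: exp_double)
    finally have "A \<le> K * exp (- (sin t)\<^sup>2 / 4)"
      by (rule power2_le_imp_le) (simp add: K_def)
    then have "A ^ m \<le> (K * exp (- (sin t)\<^sup>2 / 4)) ^ m"
      using \<open>A \<ge> 0\<close> by (rule power_mono)
    also have "\<dots> = K ^ m * exp (- m * (sin t)\<^sup>2 / 4)"
      by (simp add: power_mult_distrib flip: exp_of_nat_mult)
    finally show ?thesis using 1 by linarith
  qed
  have int: "(?F has_integral (R / 2) ^ m * (2 * pi) * ?S) {0..2*pi}"
    using has_integral_generating_function[of m "R / 2" s v] by simp
  have "(R / 2) ^ m * (2 * pi) * norm ?S = norm (integral {0..2*pi} ?F)"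
    unfolding integral_unique[OF int] using R by (simp add: norm_mult norm_power norm_divide)
  also have "\<dots> \<le> integral {0..2*pi} (\<lambda>t. K ^ m * exp (- m * (sin t)\<^sup>2 / 4))"
    by (intro integral_norm_bound_integral has_integral_integrable[OF int] le
        integrable_continuous_interval continuous_intros) auto
  also have "\<dots> = K ^ m * integral {0..2*pi} (\<lambda>t. exp (- m * (sin t)\<^sup>2 / 4))"
    by simp
  also have "\<dots> \<le> K ^ m * (3 * sqrt (pi ^ 3 / m))"
    using \<open>m > 0\<close> integral_exp_sin_squared_le[of m] by (intro mult_left_mono) (auto simp: K_def)
  also have "\<dots> = (R / 2) ^ m * (2 * pi) * (M ^ m * (8 ^ m * (3 / 2 * sqrt pi / sqrt m)))"
  proof -
    \<comment> \<open>The identity \<open>K = (R / 2) * 8 * M\<close> lets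
      \<open>(R / 2) ^ m\<close> cancel and leaves \<open>8 ^ m\<close>, which is comparable to the
      number of sign vectors.\<close>
    have "(R / 2 * (8 * M))\<^sup>2 = 8 * (R\<^sup>2 * Q + R\<^sup>2 * \<mu>\<^sup>2)"
      using \<open>Q > 0\<close> by (simp add: M_def power_mult_distrib power_divide algebra_simps)
    also have "\<dots> = K\<^sup>2"
      by (simp add: K_def add_nonneg_nonneg R power_mult_distrib)
    finally have "R / 2 * (8 * M) = K"
      by (rule power2_eq_imp_eq) (use R \<open>Q > 0\<close> in \<open>simp_all add: K_def M_def\<close>)
    then have K: "K ^ m = (R / 2) ^ m * (8 ^ m * M ^ m)"
      by (simp only: power_mult_distrib[symmetric])
    have "sqrt (pi ^ 3 / m) = sqrt (pi\<^sup>2) * sqrt pi / sqrt m"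
      by (simp only: power3_eq_cube power2_eq_square real_sqrt_mult real_sqrt_divide)
    then have "sqrt (pi ^ 3 / m) = pi * sqrt pi / sqrt m"
      by simp
    then show ?thesis
      unfolding K by (simp only:) simp
  qed
  finally have "norm ?S \<le> M ^ m * (8 ^ m * (3 / 2 * sqrt pi / sqrt m))"
    by (rule mult_left_le_imp_le) (use R(1) in simp)
  \<comment> \<open>The \<open>sqrt m\<close> from the count cancels the \<open>1 / sqrt m\<close>
    from the integral, so the final constant is independent of \<open>m\<close>.\<close>
  also have "\<dots> \<le> M ^ m * (2 * sqrt m * card (sign_vectors ?n) * (3 / 2 * sqrt pi / sqrt m))"
    using \<open>Q > 0\<close>
    by (intro mult_left_mono mult_right_mono eight_power_le_card_sign_vectors \<open>m > 0\<close>) (auto simp: M_def)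
  also have "\<dots> = 3 * sqrt pi * (card (sign_vectors ?n) * M ^ m)"
    using \<open>m > 0\<close> by simp
  also have "\<dots> \<le> 3 * sqrt 4 * (card (sign_vectors ?n) * M ^ m)"
  proof (rule mult_right_mono)
    show "3 * sqrt pi \<le> 3 * sqrt 4"
      using pi_less_4 by (intro mult_left_mono real_sqrt_le_mono) auto
    show "0 \<le> card (sign_vectors ?n) * M ^ m"
      using \<open>Q > 0\<close> by (simp add: M_def)
  qed
  finally show ?thesis
    by (simp add: M_def mult_ac)
qed

section \<open>Smoothing with the Fejer kernel\<close>

text \<open>An Esseen-type inequality in counting form. The indicator of the event is dominated by
  the kernel at \<open>u * (X \<omega> - c)\<close>, and sum and integral are exchanged. The shift
  by \<open>c\<close> only multiplies the exponential sum by a number of modulus 1, so the bound is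
  uniform in \<open>c\<close>.\<close>

lemma card_concentrated_le:
  fixes X :: "'a \<Rightarrow> real" and u c :: real
  assumes "finite A" "u > 0"
    and h: "\<And>t. t \<in> {0..1} \<Longrightarrow> norm (\<Sum>\<omega>\<in>A. cis (t * u * X \<omega>)) \<le> h t"
    and int: "h integrable_on {0..1}"
  shows "card {\<omega>\<in>A. \<bar>X \<omega> - c\<bar> \<le> 1 / u} \<le> 5 * integral {0..1} h"
proof -
  let ?f = "\<lambda>\<omega> t. (1 - t) * cos (t * (u * (X \<omega> - c)))"
  have f_int: "?f \<omega> integrable_on {0..1}" for \<omega>
    by (intro integrable_continuous_interval continuous_intros)
  have le: "(\<Sum>\<omega>\<in>A. ?f \<omega> t) \<le> h t" if t: "t \<in> {0..1}" for t
  proof -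
    have "(\<Sum>\<omega>\<in>A. cis (t * (u * (X \<omega> - c)))) = cis (- t * u * c) * (\<Sum>\<omega>\<in>A. cis (t * u * X \<omega>))"
      by (simp add: sum_distrib_left cis_mult algebra_simps)
    then have "norm (\<Sum>\<omega>\<in>A. cis (t * (u * (X \<omega> - c)))) \<le> h t"
      using h[OF t] by (simp add: norm_mult)
    moreover have "\<bar>\<Sum>\<omega>\<in>A. cos (t * (u * (X \<omega> - c)))\<bar> \<le> norm (\<Sum>\<omega>\<in>A. cis (t * (u * (X \<omega> - c))))"
      using abs_Re_le_cmod[of "\<Sum>\<omega>\<in>A. cis (t * (u * (X \<omega> - c)))"] by simp
    ultimately have 1: "\<bar>\<Sum>\<omega>\<in>A. cos (t * (u * (X \<omega> - c)))\<bar> \<le> h t" by linarith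
    have "(\<Sum>\<omega>\<in>A. ?f \<omega> t) = (1 - t) * (\<Sum>\<omega>\<in>A. cos (t * (u * (X \<omega> - c))))"
      by (simp add: sum_distrib_left)
    also have "\<dots> \<le> (1 - t) * \<bar>\<Sum>\<omega>\<in>A. cos (t * (u * (X \<omega> - c)))\<bar>"
      using t by (intro mult_left_mono) auto
    also have "\<dots> \<le> 1 * \<bar>\<Sum>\<omega>\<in>A. cos (t * (u * (X \<omega> - c)))\<bar>"
      using t by (intro mult_right_mono) auto
    finally show ?thesis using 1 by linarith
  qed
  have "\<bar>X \<omega> - c\<bar> \<le> 1 / u \<longleftrightarrow> \<bar>u * (X \<omega> - c)\<bar> \<le> 1" for \<omega>
    unfolding abs_mult using assms(2) by (simp add: field_simps)
  then have "real (card {\<omega>\<in>A. \<bar>X \<omega> - c\<bar> \<le> 1 / u}) = (\<Sum>\<omega>\<in>A. of_bool (\<bar>u * (X \<omega> - c)\<bar> \<le> 1))"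
    using assms(1) by (simp add: Int_def)
  also have "\<dots> \<le> (\<Sum>\<omega>\<in>A. 5 * integral {0..1} (?f \<omega>))"
    by (intro sum_mono indicator_le_fejer)
  also have "\<dots> = 5 * integral {0..1} (\<lambda>t. \<Sum>\<omega>\<in>A. ?f \<omega> t)"
    using assms(1) f_int by (subst integral_sum) (simp_all add: sum_distrib_left)
  also have "\<dots> \<le> 5 * integral {0..1} h"
    using assms(1) f_int int le by (intro mult_left_mono integral_le integrable_sum) auto
  finally show ?thesis .
qed

section \<open>The characteristic function and the distance to the lattice\<close>

lemma finite_pairs [simp]: "finite (pairs n)"
  by (rule finite_subset[of _ "{1..n} \<times> {1..n}"]) (auto simp: pairs_def)

text \<open>Coordinatewise rounding is one candidate in the infimum, and nonnegativity of the
  infimum permits squaring.\<close>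

lemma dist_int_lattice_le_round:
  "(dist_int_lattice I x)\<^sup>2 \<le> (\<Sum>p\<in>I. (x p - of_int (round (x p)))\<^sup>2)"
proof -
  let ?z = "\<lambda>p\<in>I. of_int (round (x p)) :: real"
  have "dist_int_lattice I x \<le> L2_set (\<lambda>p. x p - ?z p) I"
    unfolding dist_int_lattice_def
    by (rule cINF_lower) (auto intro!: bdd_belowI[of _ 0])
  moreover have "dist_int_lattice I x \<ge> 0"
    unfolding dist_int_lattice_def
    by (rule cINF_greatest) (auto simp: PiE_eq_empty_iff)
  ultimately have "(dist_int_lattice I x)\<^sup>2 \<le> (L2_set (\<lambda>p. x p - ?z p) I)\<^sup>2"
    by (rule power_mono)
  also have "L2_set (\<lambda>p. x p - ?z p) I = L2_set (\<lambda>p. x p - of_int (round (x p))) I"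
    by (intro L2_set_cong) auto
  finally show ?thesis
    by (simp add: L2_set_def sum_nonneg)
qed

text \<open>The square of indices contains the pairs, their mirror images and a diagonal whose terms
  are nonnegative.\<close>

lemma sum_pairs_le:
  fixes g :: "nat \<Rightarrow> nat \<Rightarrow> real"
  assumes "\<And>i j. g i j \<ge> 0" "\<And>i j. g i j = g j i"
  shows "2 * (\<Sum>(i, j)\<in>pairs n. g i j) \<le> (\<Sum>i = 1..n. \<Sum>j = 1..n. g i j)"
proof -
  have inj: "inj_on prod.swap (pairs n)" by simp
  have "2 * (\<Sum>(i, j)\<in>pairs n. g i j)
      = (\<Sum>(i, j)\<in>pairs n. g i j) + (\<Sum>(i, j)\<in>prod.swap ` pairs n. g i j)"
    using assms(2) by (simp add: sum.reindex[OF inj] case_prod_unfold)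
  also have "\<dots> = (\<Sum>(i, j)\<in>pairs n \<union> prod.swap ` pairs n. g i j)"
  proof (rule sum.union_disjoint[symmetric])
    show "pairs n \<inter> prod.swap ` pairs n = {}" by (auto simp: pairs_def)
  qed auto
  also have "\<dots> \<le> (\<Sum>(i, j)\<in>{1..n} \<times> {1..n}. g i j)"
    using assms(1) by (intro sum_mono2) (auto simp: pairs_def)
  finally show ?thesis by (simp add: sum.cartesian_product)
qed

text \<open>By the sum-to-product formula the quotient of the two sides is a squared cosine of
  \<open>(a + b) / 2\<close>. Bounding it by 1 leaves only the difference of the angles, whence the
  vector D(v).\<close>

lemma cos_average_squared_le:
  fixes a b :: real
  shows "((cos a + cos b) / 2)\<^sup>2 \<le> (cos ((a - b) / 2))\<^sup>2"
proof -
  have "((cos a + cos b) / 2)\<^sup>2 = (cos ((a + b) / 2))\<^sup>2 * (cos ((a - b) / 2))\<^sup>2"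
    by (simp add: cos_plus_cos power_mult_distrib)
  also have "\<dots> \<le> 1 * (cos ((a - b) / 2))\<^sup>2"
    by (intro mult_right_mono) (auto simp: abs_square_le_1)
  finally show ?thesis by simp
qed

text \<open>Averaging \<open>((x i + x j) / 2)^2\<close> over all index pairs gives
  \<open>(S2 / n + \<mu>^2) / 2\<close>. The cosine estimates bound this by
  \<open>1 - 8 E / n^2\<close>, and the power \<open>m = n / 2\<close> of its square root gives the
  exponential.\<close>

lemma norm_char_sum_le_dist:
  fixes \<theta> :: real
  assumes "m > 0"
  shows "norm (\<Sum>\<xi>\<in>sign_vectors (2 * m). cis (2 * pi * \<theta> * W (2 * m) v \<xi>))
    \<le> 6 * card (sign_vectors (2 * m)) *
      exp (- 2 * (dist_int_lattice (pairs (2 * m)) (\<lambda>p. \<theta> * diff_vec v p))\<^sup>2 / (2 * m))"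
proof -
  let ?n = "2 * m"
  define x where "x = (\<lambda>j. cos (2 * pi * \<theta> * v j))"
  define E where "E = (dist_int_lattice (pairs ?n) (\<lambda>p. \<theta> * diff_vec v p))\<^sup>2"
  define S2 where "S2 = (\<Sum>j = 1..?n. (x j)\<^sup>2)"
  define S1 where "S1 = (\<Sum>j = 1..?n. x j)"
  define \<mu> where "\<mu> = S1 / ?n"
  define B where "B = exp (- 8 * E / ?n\<^sup>2)"
  \<comment> \<open>Larger than the mean \<open>S2 / n\<close>, and positive even if all \<open>x j\<close> vanish.\<close>
  define Q where "Q = 2 * B - \<mu>\<^sup>2"
  let ?g = "\<lambda>i j. 1 - ((x i + x j) / 2)\<^sup>2"
  have "S1\<^sup>2 \<le> ?n * S2"
    using sum_squared_le_sum_of_squares[of x "{1..?n}"]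
    by (simp add: S1_def S2_def mult.commute)
  then have mu: "\<mu>\<^sup>2 \<le> S2 / ?n"
    using assms by (simp add: \<mu>_def power_divide field_simps power2_eq_square)
  \<comment> \<open>Half the difference of the angles at \<open>i\<close> and \<open>j\<close> is pi
    times the (i, j)-coordinate of \<open>\<theta>\<close> D(v), so the two cosine estimates combine
    term by term.\<close>
  have "4 * E \<le> (\<Sum>(i, j)\<in>pairs ?n. ?g i j)"
  proof -
    have "4 * (\<theta> * diff_vec v (i, j) - of_int (round (\<theta> * diff_vec v (i, j))))\<^sup>2 \<le> ?g i j" for i j
    proof -
      have arg: "pi * (\<theta> * diff_vec v (i, j)) = (2 * pi * \<theta> * v i - 2 * pi * \<theta> * v j) / 2"
        by (simp add: diff_vec_def algebra_simps)
      have "((x i + x j) / 2)\<^sup>2 \<le> (cos (pi * (\<theta> * diff_vec v (i, j))))\<^sup>2"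
        unfolding x_def arg by (rule cos_average_squared_le)
      with cos_pi_squared_le_dist_round[of "\<theta> * diff_vec v (i, j)"] show ?thesis by linarith
    qed
    then have "(\<Sum>p\<in>pairs ?n. 4 * (\<theta> * diff_vec v p - of_int (round (\<theta> * diff_vec v p)))\<^sup>2)
        \<le> (\<Sum>(i, j)\<in>pairs ?n. ?g i j)"
      by (intro sum_mono) auto
    with dist_int_lattice_le_round[of "pairs ?n" "\<lambda>p. \<theta> * diff_vec v p"] show ?thesis
      by (simp add: E_def flip: sum_distrib_left)
  qed
  also have "2 * \<dots> \<le> (\<Sum>i = 1..?n. \<Sum>j = 1..?n. ?g i j)"
  proof (rule sum_pairs_le)
    show "0 \<le> ?g i j" for i j
      using cos_average_squared_le[of "2 * pi * \<theta> * v i" "2 * pi * \<theta> * v j"]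
        abs_square_le_1[of "cos ((2 * pi * \<theta> * v i - 2 * pi * \<theta> * v j) / 2)"]
      by (simp add: x_def)
  qed (simp add: add.commute)
  also have "\<dots> = ?n\<^sup>2 - (?n * S2 + S1\<^sup>2) / 2"
  proof -
    have "?g i j = 1 - (x i)\<^sup>2 / 4 - (x j)\<^sup>2 / 4 - x i * x j / 2" for i j
      by (simp add: power2_eq_square field_simps)
    then have "(\<Sum>i = 1..?n. \<Sum>j = 1..?n. ?g i j)
        = (\<Sum>i = 1..?n. \<Sum>j = 1..?n. 1 - (x i)\<^sup>2 / 4 - (x j)\<^sup>2 / 4 - x i * x j / 2)"
      by (simp only:)
    also have "\<dots> = ?n * ?n - ?n * (S2 / 4) - ?n * (S2 / 4) - S1 * S1 / 2"
      unfolding S1_def sum_product S2_def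
      by (simp add: sum_subtractf flip: sum_divide_distrib sum_distrib_left) (simp add: field_simps)
    finally show ?thesis by (simp add: power2_eq_square field_simps)
  qed
  finally have "(?n * S2 + S1\<^sup>2) / 2 \<le> ?n\<^sup>2 - 8 * E" by linarith
  then have "(?n * S2 + S1\<^sup>2) / 2 / ?n\<^sup>2 \<le> (?n\<^sup>2 - 8 * E) / ?n\<^sup>2"
    by (rule divide_right_mono) simp
  moreover have "(?n * S2 + S1\<^sup>2) / 2 / ?n\<^sup>2 = (S2 / ?n + \<mu>\<^sup>2) / 2"
    using assms by (simp add: \<mu>_def field_simps power2_eq_square)
  moreover have "(?n\<^sup>2 - 8 * E) / ?n\<^sup>2 = 1 - 8 * E / ?n\<^sup>2"
    using assms by (simp add: diff_divide_distrib)
  ultimately have "(S2 / ?n + \<mu>\<^sup>2) / 2 \<le> 1 - 8 * E / ?n\<^sup>2" by (simp only:)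
  also have "\<dots> \<le> B"
    using exp_ge_add_one_self[of "- 8 * E / ?n\<^sup>2"] by (simp add: B_def)
  finally have 1: "S2 / ?n + \<mu>\<^sup>2 \<le> 2 * B" by simp
  have "B > 0" by (simp add: B_def)
  \<comment> \<open>The facts \<open>mu\<close> and \<open>1\<close> give
    \<open>\<mu>^2 \<le> B\<close>, hence \<open>Q \<ge> B > 0\<close>.\<close>
  then have "Q > 0" using 1 mu by (simp add: Q_def)
  moreover have "S2 \<le> ?n * Q"
    using 1 assms by (simp add: Q_def field_simps)
  ultimately have "norm (\<Sum>\<xi>\<in>sign_vectors ?n. cis (2 * pi * \<theta> * W ?n v \<xi>))
      \<le> 6 * card (sign_vectors ?n) * sqrt ((Q + \<mu>\<^sup>2) / 2) ^ m"
    using norm_char_sum_le[OF assms, of Q "2 * pi * \<theta>" v]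
    by (simp add: S2_def S1_def \<mu>_def x_def)
  \<comment> \<open>\<open>Q\<close> is chosen so that \<open>(Q + \<mu>^2) / 2\<close> is exactly
    \<open>B\<close>.\<close>
  also have "sqrt ((Q + \<mu>\<^sup>2) / 2) = exp (- 4 * E / ?n\<^sup>2)"
  proof (rule real_sqrt_unique)
    show "(exp (- 4 * E / ?n\<^sup>2))\<^sup>2 = (Q + \<mu>\<^sup>2) / 2"
      by (simp add: Q_def B_def flip: exp_double)
  qed simp
  also have "exp (- 4 * E / ?n\<^sup>2) ^ m = exp (- 2 * E / ?n)"
    using assms by (simp add: power2_eq_square flip: exp_of_nat_mult)
  finally show ?thesis by (simp add: E_def)
qed

section \<open>Concentration below the CLCD\<close>

lemma min_le_dist_of_less_CLCD:
  assumes "\<theta> > 0" "ereal \<theta> < CLCD \<alpha> \<gamma> n v"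
  shows "min (\<gamma> * L2_set (\<lambda>p. \<theta> * diff_vec v p) (pairs n)) \<alpha>
    \<le> dist_int_lattice (pairs n) (\<lambda>p. \<theta> * diff_vec v p)"
proof (rule ccontr)
  assume "\<not> ?thesis"
  with assms(1) have "CLCD \<alpha> \<gamma> n v \<le> ereal \<theta>"
    unfolding CLCD_def by (intro Inf_lower imageI) auto
  with assms(2) show False by simp
qed

text \<open>Smoothing at scale \<open>u = 2 * pi * T\<close> evaluates the character sum at
  \<open>\<theta> = t * T\<close>, which stays below the CLCD for t in [0, 1]. There the distance is
  at least \<open>\<gamma>\<close> times the norm of \<open>\<theta>\<close> D(v), giving a Gaussian
  in \<open>t\<close>, or at least \<open>\<alpha>\<close>, giving the constant \<open>e\<close>.
  The sum of the two bounds covers both cases.\<close>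

lemma prob_concentrated_le:
  fixes b \<gamma> \<alpha> T c :: real
  assumes "b > 0" "\<gamma> > 0" "\<alpha> > 0" "m > 0" "T > 0"
    and T: "ereal T < CLCD \<alpha> \<gamma> (2 * m) v"
    and b: "b * sqrt (2 * m) \<le> L2_set (diff_vec v) (pairs (2 * m))"
  shows "measure (measure_pmf (pmf_of_set (sign_vectors (2 * m))))
      {\<xi>. \<bar>W (2 * m) v \<xi> - c\<bar> \<le> 1 / (2 * pi * T)}
    \<le> 30 * (sqrt (pi / 2) / (\<gamma> * b) / T + exp (- 2 * \<alpha>\<^sup>2 / (2 * m)))"
proof -
  let ?n = "2 * m"
  let ?S = "sign_vectors ?n"
  let ?L = "L2_set (diff_vec v) (pairs ?n)"
  have card: "card ?S > 0"
    using eight_power_le_card_sign_vectors[OF \<open>m > 0\<close>] zero_less_power[of "8::real" m]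
    by (intro Nat.gr0I) (simp del: zero_less_power)
  then have S: "finite ?S" "?S \<noteq> {}" by (auto simp: card_gt_0_iff)
  \<comment> \<open>Matches \<open>t^2 / (2 \<sigma>^2)\<close> with
    \<open>2 (\<gamma> b T t)^2\<close>, the exponent obtained in the first case.\<close>
  define \<sigma> where "\<sigma> = 1 / (2 * \<gamma> * b * T)"
  have \<sigma>: "\<sigma> > 0" using assms by (simp add: \<sigma>_def)
  define e where "e = exp (- 2 * \<alpha>\<^sup>2 / ?n)"
  let ?g = "\<lambda>t. exp (- (t - 0)\<^sup>2 / (2 * \<sigma>\<^sup>2))"
  have bound: "norm (\<Sum>\<xi>\<in>?S. cis (t * (2 * pi * T) * W ?n v \<xi>)) \<le> 6 * card ?S * (?g t + e)"
    if t: "t \<in> {0..1}" for t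
  proof -
    define \<theta> where "\<theta> = t * T"
    define D where "D = dist_int_lattice (pairs ?n) (\<lambda>p. \<theta> * diff_vec v p)"
    have "exp (- 2 * D\<^sup>2 / ?n) \<le> ?g t + e"
    \<comment> \<open>The CLCD concerns only positive \<open>\<theta>\<close>; at
      \<open>t = 0\<close> the Gaussian equals 1 and the bound is trivial.\<close>
    proof (cases "t = 0")
      case True
      have "exp (- 2 * D\<^sup>2 / ?n) \<le> 1" by simp
      with True show ?thesis by (simp add: e_def add_increasing2)
    next
      case False
      with t \<open>T > 0\<close> have "\<theta> > 0" "\<theta> \<le> T" by (auto simp: \<theta>_def)
      from \<open>\<theta> \<le> T\<close> T have "ereal \<theta> < CLCD \<alpha> \<gamma> ?n v"
        by (simp add: le_less_trans[of "ereal \<theta>" "ereal T"])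
      from min_le_dist_of_less_CLCD[OF \<open>\<theta> > 0\<close> this]
      consider "\<gamma> * (\<theta> * ?L) \<le> D" | "\<alpha> \<le> D"
        using \<open>\<theta> > 0\<close> by (auto simp: D_def L2_set_left_distrib min_le_iff_disj L2_set_right_distrib[symmetric])
      then show ?thesis
      proof cases
        case 1
        have "\<gamma> * (\<theta> * (b * sqrt ?n)) \<le> \<gamma> * (\<theta> * ?L)"
          using b \<open>\<theta> > 0\<close> \<open>\<gamma> > 0\<close> by (intro mult_left_mono) auto
        also note 1
        finally have "(\<gamma> * (\<theta> * (b * sqrt ?n)))\<^sup>2 \<le> D\<^sup>2"
          using assms(1,2) \<open>\<theta> > 0\<close> by (intro power_mono) auto
        then have "2 * (\<gamma> * (\<theta> * (b * sqrt ?n)))\<^sup>2 / ?n \<le> 2 * D\<^sup>2 / ?n"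
          by (intro divide_right_mono) auto
        moreover have "2 * (\<gamma> * (\<theta> * (b * sqrt ?n)))\<^sup>2 / ?n = t\<^sup>2 / (2 * \<sigma>\<^sup>2)"
          using assms(1-5) by (simp add: \<theta>_def \<sigma>_def power_mult_distrib power_divide field_simps)
        ultimately have "exp (- 2 * D\<^sup>2 / ?n) \<le> ?g t" by simp
        then show ?thesis by (simp add: e_def add_increasing2)
      next
        case 2
        then have "\<alpha>\<^sup>2 \<le> D\<^sup>2" using \<open>\<alpha> > 0\<close> by (intro power_mono) auto
        then have "2 * \<alpha>\<^sup>2 / ?n \<le> 2 * D\<^sup>2 / ?n" by (intro divide_right_mono) auto
        then have "exp (- 2 * D\<^sup>2 / ?n) \<le> e" by (simp add: e_def)
        then show ?thesis by (simp add: add_increasing)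
      qed
    qed
    then have "6 * card ?S * exp (- 2 * D\<^sup>2 / ?n) \<le> 6 * card ?S * (?g t + e)"
      by (intro mult_left_mono) auto
    with norm_char_sum_le_dist[OF \<open>m > 0\<close>, of \<theta> v] show ?thesis
      by (simp add: D_def \<theta>_def mult_ac)
  qed
  have g_int: "?g integrable_on {0..1}"
    using \<sigma> by (intro integrable_continuous_interval continuous_intros) auto
  have "measure (measure_pmf (pmf_of_set ?S)) {\<xi>. \<bar>W ?n v \<xi> - c\<bar> \<le> 1 / (2 * pi * T)}
      = card {\<xi>\<in>?S. \<bar>W ?n v \<xi> - c\<bar> \<le> 1 / (2 * pi * T)} / card ?S"
    using S by (simp add: measure_pmf_of_set Int_def)
  also have "\<dots> \<le> 5 * integral {0..1} (\<lambda>t. 6 * card ?S * (?g t + e)) / card ?S"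
  proof (rule divide_right_mono)
    have "(\<lambda>t. 6 * card ?S * (?g t + e)) integrable_on {0..1}"
      using \<sigma> by (intro integrable_continuous_interval continuous_intros) auto
    then show "card {\<xi>\<in>?S. \<bar>W ?n v \<xi> - c\<bar> \<le> 1 / (2 * pi * T)}
        \<le> 5 * integral {0..1} (\<lambda>t. 6 * card ?S * (?g t + e))"
      using S \<open>T > 0\<close> bound by (intro card_concentrated_le) auto
  qed simp
  \<comment> \<open>30 is the product of the smoothing constant 5 and the constant 6 of the
    character bound.\<close>
  also have "\<dots> = 30 * integral {0..1} (\<lambda>t. ?g t + e)"
    using card by simp
  also have "integral {0..1} (\<lambda>t. ?g t + e) = integral {0..1} ?g + e"
    using integral_add[OF g_int integrable_const_ivl[of e 0 1]] by simp
  also have "integral {0..1} ?g \<le> sqrt (2 * pi * \<sigma>\<^sup>2)"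
    by (rule integral_gaussian_le[OF \<sigma>])
  also have "sqrt (2 * pi * \<sigma>\<^sup>2) = sqrt (pi / 2) / (\<gamma> * b) / T"
  proof (rule real_sqrt_unique)
    show "(sqrt (pi / 2) / (\<gamma> * b) / T)\<^sup>2 = 2 * pi * \<sigma>\<^sup>2"
      using assms(1-5) by (simp add: \<sigma>_def power_divide power_mult_distrib field_simps)
  qed (use assms(1-5) in simp)
  finally show ?thesis by (simp add: e_def)
qed

section \<open>The choice of scale\<close>

theorem theorem1p3:
  fixes b \<gamma> :: real
  assumes "b > 0" and "0 < \<gamma>" and "\<gamma> < 1"
  shows "\<exists>C::real. C > 0 \<and>
    (\<forall>(n::nat) (v::nat \<Rightarrow> real). n > 0 \<longrightarrow> even n \<longrightarrow>
       L2_set (diff_vec v) (pairs n) \<ge> b * sqrt (real n) \<longrightarrow>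
       (\<forall>(\<alpha>::real) (\<epsilon>::real). \<alpha> > 0 \<longrightarrow> \<epsilon> \<ge> 0 \<longrightarrow>
          ereal (levy_conc (measure_pmf (pmf_of_set (sign_vectors n))) (W n v) \<epsilon>)
            \<le> ereal (C * \<epsilon>) + ereal C / CLCD \<alpha> \<gamma> n v
              + ereal (C * exp (- 2 * \<alpha>\<^sup>2 / real n))))"
proof -
  define K where "K = 30 * (sqrt (pi / 2) / (\<gamma> * b))"
  have "K > 0" using assms by (simp add: K_def)
  \<comment> \<open>The three summands serve the coefficient of \<open>\<epsilon>\<close>, the
    choice \<open>\<eta> = 2 / l\<close> for a finite CLCD \<open>l\<close>, and the exponential
    term.\<close>
  define C where "C = 2 * pi * K + 2 * K + 30"
  have C: "C > 0" "30 \<le> C" "K * (2 * pi) \<le> C" "2 * K \<le> C"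
    using \<open>K > 0\<close> by (auto simp: C_def add_pos_pos)
  show ?thesis
  proof (intro exI[of _ C] conjI allI impI)
    fix n :: nat and v :: "nat \<Rightarrow> real" and \<alpha> \<epsilon> :: real
    assume "n > 0" "even n" and b: "L2_set (diff_vec v) (pairs n) \<ge> b * sqrt (real n)"
      and "\<alpha> > 0" "\<epsilon> \<ge> 0"
    obtain m where n: "n = 2 * m" using \<open>even n\<close> by blast
    with \<open>n > 0\<close> have "m > 0" by simp
    define L where "L = CLCD \<alpha> \<gamma> n v"
    define e where "e = exp (- 2 * \<alpha>\<^sup>2 / real n)"
    let ?lc = "levy_conc (measure_pmf (pmf_of_set (sign_vectors n))) (W n v) \<epsilon>"
    have "L \<ge> 0"
      unfolding L_def CLCD_def by (intro Inf_greatest) auto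
    \<comment> \<open>The scale \<open>T = 1 / (\<eta> + 2 * pi * \<epsilon>)\<close> has a window
      of width at least \<open>\<epsilon>\<close>. The slack \<open>\<eta> > 0\<close> keeps
      \<open>T\<close> finite when \<open>\<epsilon> = 0\<close> and allows it to be pushed below
      the CLCD.\<close>
    have bound: "?lc \<le> K * (\<eta> + 2 * pi * \<epsilon>) + C * e"
      if "\<eta> > 0" "ereal (1 / (\<eta> + 2 * pi * \<epsilon>)) < L" for \<eta>
    proof -
      define T where "T = 1 / (\<eta> + 2 * pi * \<epsilon>)"
      have "\<eta> + 2 * pi * \<epsilon> > 0" using that(1) \<open>\<epsilon> \<ge> 0\<close> by (simp add: add_pos_nonneg)
      then have "T > 0" by (simp add: T_def)
      have "\<epsilon> \<le> 1 / (2 * pi * T)"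
        using that(1) by (simp add: T_def field_simps)
      have "?lc \<le> 30 * (sqrt (pi / 2) / (\<gamma> * b) / T + e)"
        unfolding levy_conc_def
      proof (rule cSUP_least)
        fix c
        have "measure (measure_pmf (pmf_of_set (sign_vectors n)))
            {\<omega> \<in> space (measure_pmf (pmf_of_set (sign_vectors n))). \<bar>W n v \<omega> - c\<bar> \<le> \<epsilon>}
          \<le> measure (measure_pmf (pmf_of_set (sign_vectors n))) {\<omega>. \<bar>W n v \<omega> - c\<bar> \<le> 1 / (2 * pi * T)}"
          using \<open>\<epsilon> \<le> 1 / (2 * pi * T)\<close> by (intro measure_pmf.finite_measure_mono) auto
        also have "\<dots> \<le> 30 * (sqrt (pi / 2) / (\<gamma> * b) / T + e)"
          using prob_concentrated_le[OF assms(1,2) \<open>\<alpha> > 0\<close> \<open>m > 0\<close> \<open>T > 0\<close>, of v c] that(2) b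
          by (simp add: n T_def L_def e_def)
        finally show "measure (measure_pmf (pmf_of_set (sign_vectors n)))
            {\<omega> \<in> space (measure_pmf (pmf_of_set (sign_vectors n))). \<bar>W n v \<omega> - c\<bar> \<le> \<epsilon>}
          \<le> 30 * (sqrt (pi / 2) / (\<gamma> * b) / T + e)" .
      qed simp
      also have "\<dots> = K * (\<eta> + 2 * pi * \<epsilon>) + 30 * e"
        by (simp add: K_def T_def algebra_simps)
      also have "\<dots> \<le> K * (\<eta> + 2 * pi * \<epsilon>) + C * e"
        using C by (simp add: e_def)
      finally show ?thesis .
    qed
    have eps: "K * (2 * pi * \<epsilon>) \<le> C * \<epsilon>"
      using mult_right_mono[OF C(3) \<open>\<epsilon> \<ge> 0\<close>] by (simp add: mult_ac)
    show "ereal ?lc \<le> ereal (C * \<epsilon>) + ereal C / CLCD \<alpha> \<gamma> n v + ereal (C * exp (- 2 * \<alpha>\<^sup>2 / real n))"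
      unfolding L_def[symmetric] e_def[symmetric]
    proof (cases L)
      case (real l)
      show "ereal ?lc \<le> ereal (C * \<epsilon>) + ereal C / L + ereal (C * e)"
      proof (cases "l = 0")
        \<comment> \<open>Here \<open>C / 0 = \<infinity>\<close> in \<open>ereal\<close>, so the
          right-hand side is infinite.\<close>
        case True
        with real C show ?thesis by (simp add: divide_ereal_def)
      next
        case False
        with \<open>L \<ge> 0\<close> real have "l > 0" by simp
        \<comment> \<open>With \<open>\<eta> = 2 / l\<close> the scale is at most
          \<open>l / 2\<close>, strictly below the CLCD.\<close>
        have "1 / (2 / l + 2 * pi * \<epsilon>) \<le> 1 / (2 / l)"
          using \<open>l > 0\<close> \<open>\<epsilon> \<ge> 0\<close> by (intro divide_left_mono) (auto simp: add_pos_nonneg)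
        also have "\<dots> < l" using \<open>l > 0\<close> by simp
        finally have "?lc \<le> K * (2 / l + 2 * pi * \<epsilon>) + C * e"
          using \<open>l > 0\<close> real by (intro bound) auto
        also have "\<dots> \<le> C * \<epsilon> + C / l + C * e"
          using eps divide_right_mono[OF C(4), of l] \<open>l > 0\<close> by (simp add: algebra_simps)
        finally show ?thesis using real \<open>l > 0\<close> by simp
      qed
    next
      case PInf
      have "?lc \<le> C * \<epsilon> + C * e"
      proof (rule field_le_epsilon)
        \<comment> \<open>Every scale is admissible when the CLCD is infinite;
          \<open>\<eta> = d / K\<close> contributes only \<open>d\<close>.\<close>
        fix d :: real assume "d > 0"
        then have "?lc \<le> K * (d / K + 2 * pi * \<epsilon>) + C * e"
          using \<open>K > 0\<close> PInf by (intro bound) auto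
        also have "\<dots> \<le> C * \<epsilon> + C * e + d"
          using eps \<open>K > 0\<close> by (simp add: algebra_simps)
        finally show "?lc \<le> C * \<epsilon> + C * e + d" .
      qed
      with PInf show "ereal ?lc \<le> ereal (C * \<epsilon>) + ereal C / L + ereal (C * e)" by simp
    qed (use \<open>L \<ge> 0\<close> in simp)
  qed (rule C)
qed

end
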